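(* For all integers $n\ge 0$, \[ a_{4,1}(n)\ge a_{4,3}(n). \]
   Context: A partition of $n$ is a non-increasing sequence of positive integers summing to $n$; its Young diagram is the left-justified array of boxes whose $i$-th row has $\lambda_i$ boxes. The hook length of a box is the number of boxes directly to its right, plus the number directly below it, plus $1$; a box of hook length $k$ is a $k$-hook. For $t\ge 2$, a $t$-core partition is a partition none of whose hook lengths is divisible by $t$. $a_{t,k}(n)$ denotes the total number of hooks of length $k$ summed over all $t$-core partitions of $n$. *)

theory Defs
  imports Main
begin

definition is_partition :: "nat list \<Rightarrow> nat \<Rightarrow> bool" where
  "is_partition p n \<longleftrightarrow>
     sorted_wrt (\<ge>) p \<and> (\<forall>x\<in>set p. 0 < x) \<and> sum_list p = n"

(* A box is a pair (row, column), both counted from 0, with rows numbered downwards. *)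
definition young_diagram :: "nat list \<Rightarrow> (nat \<times> nat) set" where
  "young_diagram p = {(i, j). i < length p \<and> j < p ! i}"

(* Only meaningful for boxes (i, j) of the diagram. *)
definition hook_length :: "nat list \<Rightarrow> nat \<times> nat \<Rightarrow> nat" where
  "hook_length p = (\<lambda>(i, j).
     card {j'. j < j' \<and> (i, j') \<in> young_diagram p} +
     card {i'. i < i' \<and> (i', j) \<in> young_diagram p} + 1)"

definition num_hooks :: "nat \<Rightarrow> nat list \<Rightarrow> nat" where
  "num_hooks k p = card {b \<in> young_diagram p. hook_length p b = k}"

definition is_core :: "nat \<Rightarrow> nat list \<Rightarrow> bool" where
  "is_core t p \<longleftrightarrow> (\<forall>b\<in>young_diagram p. \<not> t dvd hook_length p b)"

definition core_partitions :: "nat \<Rightarrow> nat \<Rightarrow> nat list set" where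
  "core_partitions t n = {p. is_partition p n \<and> is_core t p}"

definition core_hooks :: "nat \<Rightarrow> nat \<Rightarrow> nat \<Rightarrow> nat" where
  "core_hooks t k n = (\<Sum>p\<in>core_partitions t n. num_hooks k p)"

(* The next two lemmas show that the cardinality in num_hooks and the sum in core_hooks
   range over finite sets, so neither takes its default value 0. *)
lemma finite_young_diagram: "finite (young_diagram p)"
proof -
  have "young_diagram p = Sigma {..<length p} (\<lambda>i. {..<p ! i})"
    by (auto simp: young_diagram_def)
  then show ?thesis by simp
qed

lemma finite_core_partitions: "finite (core_partitions t n)"
proof -
  have len: "length xs \<le> sum_list xs" if "\<forall>x\<in>set xs. 0 < x" for xs :: "nat list"
    using that by (induction xs) auto
  have "core_partitions t n \<subseteq> {xs. set xs \<subseteq> {..n} \<and> length xs \<le> n}"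
    using len by (auto simp: core_partitions_def is_partition_def dest: member_le_sum_list)
  then show ?thesis
    by (rule finite_subset) (simp add: finite_lists_length_le)
qed

end

theory Submission
  imports Defs
begin

text \<open>
  The inequality holds for every single core. If the box \<open>(i, j)\<close> of a \<open>(k + 1)\<close>-core has hook
  length \<open>k\<close>, then the row above row \<open>i\<close>, if any, is strictly longer than row \<open>i\<close>, as otherwise the
  box \<open>(i - 1, j)\<close> would have hook length \<open>k + 1\<close>. So row \<open>i\<close> is the first row of its length, and
  since hook lengths strictly decrease along a row, a \<open>k\<close>-hook is determined by the length of its
  row. Hence there are at most as many \<open>k\<close>-hooks as distinct parts, that is, corners.
\<close>

lemma is_partition_antimono:
  assumes "is_partition p n" "i \<le> j" "j < length p"
  shows "p ! j \<le> p ! i"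
  using assms by (cases "i = j") (auto simp: is_partition_def sorted_wrt_iff_nth_less)

lemma hook_length_eq:
  assumes "i < length p"
  shows "hook_length p (i, j) =
    (p ! i - Suc j) + card {i'. i < i' \<and> i' < length p \<and> j < p ! i'} + 1"
proof -
  have "{j'. j < j' \<and> (i, j') \<in> young_diagram p} = {Suc j..<p ! i}"
    using assms by (auto simp: young_diagram_def)
  then show ?thesis
    by (simp add: hook_length_def young_diagram_def)
qed

lemma hook_length_strict_decreasing:
  assumes "(i, j') \<in> young_diagram p" "j < j'"
  shows "hook_length p (i, j') < hook_length p (i, j)"
proof -
  have i: "i < length p" and j': "j' < p ! i"
    using assms by (auto simp: young_diagram_def)
  have "card {i'. i < i' \<and> i' < length p \<and> j' < p ! i'}
      \<le> card {i'. i < i' \<and> i' < length p \<and> j < p ! i'}"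
    using assms(2) by (intro card_mono) auto
  then show ?thesis
    using assms(2) i j' by (simp add: hook_length_eq)
qed

text \<open>Rows of equal length give both boxes the same arm, and the leg of the upper box gains
  exactly the box \<open>(Suc i, j)\<close>.\<close>

lemma hook_length_equal_rows:
  assumes "(Suc i, j) \<in> young_diagram p" "p ! i = p ! Suc i"
  shows "hook_length p (i, j) = Suc (hook_length p (Suc i, j))"
proof -
  have i: "Suc i < length p" and j: "j < p ! Suc i"
    using assms by (auto simp: young_diagram_def)
  have "{i'. i < i' \<and> i' < length p \<and> j < p ! i'}
      = insert (Suc i) {i'. Suc i < i' \<and> i' < length p \<and> j < p ! i'}"
    using i j by (auto simp: Suc_lessI)
  then show ?thesis
    using i assms(2) by (simp add: hook_length_eq)
qed

lemma core_hook_row_less_above: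
  assumes "is_partition p n" "is_core (Suc k) p"
    and "(Suc i, j) \<in> young_diagram p" "hook_length p (Suc i, j) = k"
  shows "p ! Suc i < p ! i"
proof (rule ccontr)
  assume "\<not> p ! Suc i < p ! i"
  moreover have "p ! Suc i \<le> p ! i"
    using assms by (intro is_partition_antimono) (auto simp: young_diagram_def)
  ultimately have "p ! i = p ! Suc i"
    by simp
  with assms have "hook_length p (i, j) = Suc k" "(i, j) \<in> young_diagram p"
    by (auto simp: hook_length_equal_rows young_diagram_def)
  with assms(2) show False
    unfolding is_core_def by (metis dvd_refl)
qed

text \<open>The strict drop directly above row \<open>i'\<close> extends to every earlier row,
  because row lengths do not increase downwards.\<close>

lemma core_hook_row_first:
  assumes "is_partition p n" "is_core (Suc k) p"
    and "(i', j) \<in> young_diagram p" "hook_length p (i', j) = k" "i < i'"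
  shows "p ! i' < p ! i"
proof -
  obtain m where m: "i' = Suc m" "i \<le> m"
    using assms(5) by (cases i') auto
  have "p ! Suc m < p ! m"
    using assms m by (intro core_hook_row_less_above) auto
  also have "p ! m \<le> p ! i"
    using assms m by (intro is_partition_antimono) (auto simp: young_diagram_def)
  finally show ?thesis
    using m by simp
qed

lemma num_hooks_core_le_card_parts:
  assumes "is_partition p n" "is_core (Suc k) p"
  shows "num_hooks k p \<le> card (set p)"
proof -
  let ?H = "{b \<in> young_diagram p. hook_length p b = k}"
  have "inj_on (\<lambda>(i, j). p ! i) ?H"
  proof (rule inj_onI, clarify)
    fix i j i' j'
    assume b: "(i, j) \<in> young_diagram p" "k = hook_length p (i, j)"
      and b': "(i', j') \<in> young_diagram p" "hook_length p (i', j') = hook_length p (i, j)"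
      and eq: "p ! i = p ! i'"
    \<comment> \<open>Otherwise the lower of the two rows, which also contains a
      \<open>k\<close>-hook, would be strictly shorter than the upper one, against
      \<open>eq\<close>.\<close>
    have "i = i'"
      using core_hook_row_first[OF assms b(1) b(2)[symmetric], of i']
        core_hook_row_first[OF assms b'(1) b'(2)[folded b(2)], of i] eq
      by (metis less_irrefl linorder_neqE_nat)
    moreover from this have "j = j'"
      using hook_length_strict_decreasing b b' by (metis less_irrefl linorder_neqE_nat)
    ultimately show "i = i' \<and> j = j'"
      by simp
  qed
  moreover have "(\<lambda>(i, j). p ! i) ` ?H \<subseteq> set p"
    by (auto simp: young_diagram_def)
  ultimately show ?thesis
    unfolding num_hooks_def by (intro card_inj_on_le) auto
qed

text \<open>Each part size \<open>v\<close> yields a corner, the last box of the last row of length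
  \<open>v\<close>. Its column \<open>v - 1\<close> recovers \<open>v\<close>, so the map
  \<open>Suc j\<close> on corners covers all part sizes.\<close>

lemma card_parts_le_num_hooks_1:
  assumes "is_partition p n"
  shows "card (set p) \<le> num_hooks 1 p"
proof -
  let ?C = "{b \<in> young_diagram p. hook_length p b = 1}"
  have "v \<in> (\<lambda>(i, j). Suc j) ` ?C" if v: "v \<in> set p" for v
  proof -
    define I where "I = {i. i < length p \<and> p ! i = v}"
    define m where "m = Max I"
    have "finite I" "I \<noteq> {}"
      using v by (auto simp: I_def in_set_conv_nth)
    then have "m \<in> I" and max: "i \<le> m" if "i \<in> I" for i
      using that by (auto simp: m_def)
    then have m: "m < length p" "p ! m = v"
      using \<open>I \<noteq> {}\<close> by (auto simp: I_def)
    have "v > 0"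
      using assms v by (simp add: is_partition_def)
    \<comment> \<open>The leg is empty: a lower row reaching column \<open>v - 1\<close> has length
      at least \<open>v\<close>, hence exactly \<open>v\<close> by monotonicity, against the
      maximality of \<open>m\<close>.\<close>
    have "{i'. m < i' \<and> i' < length p \<and> v - 1 < p ! i'} = {}"
    proof safe
      fix i assume i: "m < i" "i < length p" "v - 1 < p ! i"
      then have "p ! i \<le> p ! m"
        using assms by (intro is_partition_antimono) auto
      with i m have "i \<in> I"
        by (auto simp: I_def)
      with max i show "i \<in> {}"
        by fastforce
    qed
    then have "hook_length p (m, v - 1) = 1"
      using m by (simp only: hook_length_eq) simp
    then have "(m, v - 1) \<in> ?C"
      using m \<open>v > 0\<close> by (simp add: young_diagram_def)
    then show ?thesis
      using \<open>v > 0\<close> by (intro image_eqI[of _ _ "(m, v - 1)"]) auto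
  qed
  then have "card (set p) \<le> card ((\<lambda>(i, j). Suc j) ` ?C)"
    by (intro card_mono) (auto simp: finite_young_diagram)
  also have "\<dots> \<le> card ?C"
    by (intro card_image_le) (simp add: finite_young_diagram)
  finally show ?thesis
    by (simp add: num_hooks_def)
qed

text \<open>Termwise comparison: for each core, the number of distinct parts lies between the two
  hook counts.\<close>

lemma core_hooks_le_core_hooks_1: "core_hooks (Suc k) k n \<le> core_hooks (Suc k) 1 n"
  unfolding core_hooks_def
proof (rule sum_mono)
  fix p assume "p \<in> core_partitions (Suc k) n"
  then have p: "is_partition p n" "is_core (Suc k) p"
    by (auto simp: core_partitions_def)
  show "num_hooks k p \<le> num_hooks 1 p"
    using num_hooks_core_le_card_parts[OF p] card_parts_le_num_hooks_1[OF p(1)] by linarith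
qed

theorem theorem1p4:
  fixes n :: nat
  shows "core_hooks 4 1 n \<ge> core_hooks 4 3 n"
  using core_hooks_le_core_hooks_1[of 3 n] by simp

end
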